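(* Let $\Omega,\mathcal H,\Gamma,t,T,L,C_i,C_j,\varepsilon_i,\varepsilon_j,\tau_i,\tau_j,B_i,B_j,P_i,P_j$ satisfy all the conditions of the common bi-Lipschitz random map setting described in the context. Let $G_{ij}:=W_{2,d_\Omega}(C_i,C_j)$ be the quadratic Wasserstein distance between $C_i$ and $C_j$ with ground metric $d_\Omega$, let $\tau_{ij}:=\tau_i+\tau_j$, and let $(x)_+:=\max\{x,0\}$. Let $W_{2,\Gamma}(P_i,P_j)\ge 0$ be defined by $$W_{2,\Gamma}^2(P_i,P_j)=\inf_\pi\int\|\Gamma^{1/2}b-\Gamma^{1/2}b'\|_{\mathcal H}^2\,d\pi(b,b'),$$ the infimum being over all couplings $\pi$ of $P_i$ and $P_j$. Then $$\bigl(L^{-1}G_{ij}-\tau_{ij}\bigr)_+\;\le\; W_{2,\Gamma}(P_i,P_j)\;\le\; L\,G_{ij}+\tau_{ij}.$$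
   Context: Common bi-Lipschitz random map setting. $(\Omega,d_\Omega)$ is a Polish metric space with its Borel $\sigma$-algebra; $\mathcal P_2(\Omega)$ is the set of Borel probability measures $C$ on $\Omega$ with $\int_\Omega d_\Omega(\omega,\omega_0)^2\,C(d\omega)<\infty$ for some (equivalently any) $\omega_0\in\Omega$. $\mathcal H$ is a real separable Hilbert space; $\Gamma:\mathcal H\to\mathcal H$ is a bounded, positive, self-adjoint operator and $\Gamma^{1/2}$ is its unique bounded positive square root. The common carrier $t:\Omega\to\mathcal H$ is Borel measurable, and $t_\Gamma:=\Gamma^{1/2}\circ t$ is a Borel embedding with a Borel inverse on its image. For some $L\ge 1$ and all $x,y\in\Omega$, $$L^{-1}d_\Omega(x,y)\le\|t_\Gamma(x)-t_\Gamma(y)\|_{\mathcal H}\le L\,d_\Omega(x,y).$$ $\mathcal U$ is a measurable space and $T:\Omega\times\mathcal U\to\mathcal H$ is (Borel) measurable. $C_i,C_j\in\mathcal P_2(\Omega)$ are the characteristic laws of two firms $i,j$. For $k\in\{i,j\}$, $X_k\sim C_k$, $U_k$ is a $\mathcal U$-valued transmission draw with a law common to both firms, and the exposure random element is $$B_k=T(X_k,U_k)=t(X_k)+\varepsilon_k(X_k,U_k),$$ where $\varepsilon_k:\Omega\times\mathcal U\to\mathcal H$ is Borel measurable with $\|\Gamma^{1/2}\varepsilon_k(x,u)\|_{\mathcal H}\le\tau_k$ for all $(x,u)$, for a constant $\tau_k\ge0$. The exposure law is $P_k:=\mathcal L(B_k)$; equivalently $P_k=C_kK$ for the stochastic kernel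 $K(x,\cdot)=\mathcal L(T(x,U))$ with $U$ a transmission draw. It is assumed that $P_i,P_j\in\mathcal P_2(\mathcal H)$, i.e. $P_i$ and $P_j$ have finite second moment (hence also finite $\Gamma$-weighted second moment). The quadratic Wasserstein distance on $\mathcal P_2(\Omega)$ is $W_{2,d_\Omega}(C,C')=\bigl(\inf_\gamma\int d_\Omega(x,y)^2\,d\gamma(x,y)\bigr)^{1/2}$, the infimum being over couplings $\gamma$ of $C$ and $C'$. *)

theory Defs
  imports "HOL-Probability.Probability"
begin

definition second_moment_measures :: "'a::metric_space measure set" where
  "second_moment_measures =
    {C. prob_space C \<and> sets C = sets borel \<and>
        (\<exists>w0. (\<integral>\<^sup>+ w. ennreal ((dist w w0)\<^sup>2) \<partial>C) < \<infinity>)}"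

definition couplings :: "'a measure \<Rightarrow> 'b measure \<Rightarrow> ('a \<times> 'b) measure set" where
  "couplings P Q =
    {\<pi>. sets \<pi> = sets (P \<Otimes>\<^sub>M Q) \<and> distr \<pi> P fst = P \<and> distr \<pi> Q snd = Q}"

text \<open>
  The quadratic Wasserstein distance for a ground (pseudo)metric \<open>d\<close>.
  The transport cost is a nonnegative integral, so it is \<open>\<infinity>\<close> rather than \<open>0\<close> when it
  diverges. Since \<open>enn2real\<close> sends \<open>\<infinity>\<close> to \<open>0\<close>, the real value is meaningful only if some
  coupling has finite cost; for two measures with finite second \<open>d\<close>-moments the product
  measure is such a coupling.
\<close>

definition wasserstein2 :: "('a \<Rightarrow> 'a \<Rightarrow> real) \<Rightarrow> 'a measure \<Rightarrow> 'a measure \<Rightarrow> real" where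
  "wasserstein2 d P Q =
    sqrt (enn2real (INF \<pi>\<in>couplings P Q. \<integral>\<^sup>+ z. ennreal ((d (fst z) (snd z))\<^sup>2) \<partial>\<pi>))"

text \<open>
  On a real Hilbert space a nonnegative quadratic form does not entail self-adjointness,
  and square roots are unique only among self-adjoint nonnegative operators; hence both
  conditions are required of the operator and of its square root.
\<close>

definition positive_selfadjoint :: "('h::real_inner \<Rightarrow>\<^sub>L 'h) \<Rightarrow> bool" where
  "positive_selfadjoint A \<longleftrightarrow>
    (\<forall>x y. blinfun_apply A x \<bullet> y = x \<bullet> blinfun_apply A y) \<and>
    (\<forall>x. 0 \<le> blinfun_apply A x \<bullet> x)"

definition is_positive_sqrt :: "('h::real_inner \<Rightarrow>\<^sub>L 'h) \<Rightarrow> ('h \<Rightarrow>\<^sub>L 'h) \<Rightarrow> bool" where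
  "is_positive_sqrt R A \<longleftrightarrow> positive_selfadjoint R \<and> R o\<^sub>L R = A"

definition borel_embedding :: "('a::topological_space \<Rightarrow> 'b::topological_space) \<Rightarrow> bool" where
  "borel_embedding f \<longleftrightarrow>
    f \<in> borel_measurable borel \<and> inj f \<and>
    inv f \<in> borel_measurable (restrict_space borel (range f))"

end

theory Submission
  imports Defs
begin

text \<open>
  The joint law of \<open>X\<^sub>k\<close> and \<open>B\<^sub>k\<close> transports \<open>C\<^sub>k\<close> to \<open>P\<^sub>k\<close> with error at most \<open>\<tau>\<^sub>k\<close> when
  points are compared through \<open>\<Gamma>half \<circ> t\<close> and \<open>\<Gamma>half\<close>, so both bounds follow from a triangle
  inequality for transport plans. Disintegration is avoided in the gluing step: the
  intermediate space is cut into countably many cells of diameter at most \<open>\<delta>\<close>, the two plans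
  are glued independently conditional on the cell, and \<open>\<delta>\<close> tends to \<open>0\<close>. Minkowski's
  inequality reduces to the pointwise bound
  \<open>(u + v + w)\<^sup>2 \<le> (a + b + c) (u\<^sup>2 / a + v\<^sup>2 / b + w\<^sup>2 / c)\<close>.
\<close>

subsection \<open>Gluing along a discrete variable\<close>

text \<open>Normalisation of the gluing density: \<open>inverse (q n)\<close> is integrated over a
  cell of mass \<open>q n\<close>. Finiteness of \<open>N\<close> keeps \<open>q n\<close> below
  infinity, so the quotient is 1.\<close>

lemma nn_integral_same_cell:
  fixes v :: "'b \<Rightarrow> nat"
  assumes "finite_measure N" and [measurable]: "v \<in> measurable N (count_space UNIV)"
    and q: "q n = emeasure N {y \<in> space N. v y = n}" and "q n \<noteq> 0"
  shows "(\<integral>\<^sup>+ y. (if n = v y then inverse (q n) else 0) \<partial>N) = 1"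
proof -
  interpret finite_measure N by fact
  have "(\<integral>\<^sup>+ y. (if n = v y then inverse (q n) else 0) \<partial>N)
      = (\<integral>\<^sup>+ y. inverse (q n) * indicator {y \<in> space N. v y = n} y \<partial>N)"
    by (intro nn_integral_cong) (auto simp: indicator_def)
  also have "\<dots> = inverse (q n) * q n"
    by (simp add: nn_integral_cmult_indicator q)
  also have "\<dots> = 1"
    using \<open>q n \<noteq> 0\<close> q emeasure_finite[of "{y \<in> space N. v y = n}"]
    by (metis ennreal_divide_self divide_ennreal_def mult.commute ennreal_zero_less_top top.not_eq_extremum)
  finally show ?thesis .
qed

text \<open>There are only countably many cells, so the null ones together form a null set.\<close>

lemma AE_cell_nonnull:
  fixes u :: "'a \<Rightarrow> nat"
  assumes [measurable]: "u \<in> measurable M (count_space UNIV)"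
    and q: "\<And>n. q n = emeasure M {x \<in> space M. u x = n}"
  shows "AE x in M. q (u x) \<noteq> 0"
proof -
  have "AE x in M. u x = n \<longrightarrow> q n \<noteq> 0" for n
  proof (cases "q n = 0")
    case True
    then have "{x \<in> space M. u x = n} \<in> null_sets M"
      by (auto simp: null_sets_def q)
    then show ?thesis
      by (rule AE_I') (auto simp: True)
  qed simp
  then have "AE x in M. \<forall>n. u x = n \<longrightarrow> q n \<noteq> 0"
    by (intro AE_all_countable[THEN iffD2] allI)
  then show ?thesis by eventually_elim simp
qed

text \<open>Given the common label, the two points are drawn independently, which yields an explicit
  density with respect to the product measure.\<close>

lemma glue_discrete:
  fixes u :: "'a \<Rightarrow> nat" and v :: "'b \<Rightarrow> nat"
  assumes "prob_space M" "prob_space N"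
    and u[measurable]: "u \<in> measurable M (count_space UNIV)"
    and v[measurable]: "v \<in> measurable N (count_space UNIV)"
    and eq: "distr M (count_space UNIV) u = distr N (count_space UNIV) v"
  obtains \<sigma> where "\<sigma> \<in> couplings M N" "AE w in \<sigma>. u (fst w) = v (snd w)"
proof -
  interpret M: prob_space M by fact
  interpret N: prob_space N by fact
  interpret MN: pair_sigma_finite M N ..
  define q where "q n = emeasure M {x \<in> space M. u x = n}" for n
  have qv: "q n = emeasure N {y \<in> space N. v y = n}" for n
  proof -
    have "q n = emeasure (distr M (count_space UNIV) u) {n}"
      by (simp add: q_def emeasure_distr vimage_def Int_def conj_commute)
    also have "\<dots> = emeasure N {y \<in> space N. v y = n}"
      by (simp add: eq emeasure_distr vimage_def Int_def conj_commute)
    finally show ?thesis .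
  qed
  have [measurable]: "(\<lambda>w. q (u (fst w))) \<in> borel_measurable (M \<Otimes>\<^sub>M N)"
    by (rule measurable_compose[of _ _ "count_space UNIV"]) simp_all
  \<comment> \<open>Equality of labels is a countable union over their common value, each piece
    being a measurable rectangle.\<close>
  have "Measurable.pred (M \<Otimes>\<^sub>M N) (\<lambda>w. \<exists>n. u (fst w) = n \<and> v (snd w) = n)"
    by measurable
  then have [measurable]: "Measurable.pred (M \<Otimes>\<^sub>M N) (\<lambda>w. u (fst w) = v (snd w))"
    by (simp add: eq_commute)
  \<comment> \<open>Density of the mixture, with weights \<open>q n\<close>, of the products of
    \<open>M\<close> conditioned on \<open>u = n\<close> and \<open>N\<close> conditioned on
    \<open>v = n\<close>: the weight cancels one of the two factors
    \<open>inverse (q n)\<close>.\<close>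
  define \<phi> where "\<phi> w = (if u (fst w) = v (snd w) then inverse (q (u (fst w))) else 0)" for w
  have \<phi>[measurable]: "\<phi> \<in> borel_measurable (M \<Otimes>\<^sub>M N)"
    unfolding \<phi>_def[abs_def] by measurable
  define \<sigma> where "\<sigma> = density (M \<Otimes>\<^sub>M N) \<phi>"
  have sets_\<sigma>: "sets \<sigma> = sets (M \<Otimes>\<^sub>M N)" by (simp add: \<sigma>_def)
  have [measurable]: "fst \<in> measurable \<sigma> M" "snd \<in> measurable \<sigma> N"
    unfolding \<sigma>_def by simp_all
  have "emeasure (distr \<sigma> M fst) A = emeasure M A" if [measurable]: "A \<in> sets M" for A
  proof -
    have "emeasure (distr \<sigma> M fst) A = (\<integral>\<^sup>+ w. \<phi> w * indicator A (fst w) \<partial>(M \<Otimes>\<^sub>M N))"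
      by (subst nn_integral_indicator[symmetric], simp, subst nn_integral_distr)
        (simp_all add: \<sigma>_def nn_integral_density)
    also have "\<dots> = (\<integral>\<^sup>+ x. \<integral>\<^sup>+ y. \<phi> (x, y) * indicator A x \<partial>N \<partial>M)"
      by (subst N.nn_integral_fst[symmetric]) simp_all
    also have "\<dots> = (\<integral>\<^sup>+ x. (\<integral>\<^sup>+ y. \<phi> (x, y) \<partial>N) * indicator A x \<partial>M)"
      by (intro nn_integral_cong nn_integral_multc) measurable
    also have "\<dots> = (\<integral>\<^sup>+ x. indicator A x \<partial>M)"
    \<comment> \<open>The inner integral is 1 except for \<open>x\<close> in cells of mass 0, where
      the factor is \<open>inverse 0 = \<top>\<close>; such \<open>x\<close> form a null
      set.\<close>
    proof (intro nn_integral_cong_AE, use AE_cell_nonnull[OF u q_def] in eventually_elim)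
      case (elim x)
      have "(\<integral>\<^sup>+ y. \<phi> (x, y) \<partial>N) = 1"
        using nn_integral_same_cell[where q = q, OF N.finite_measure_axioms v qv elim]
        by (simp add: \<phi>_def cong: if_cong)
      then show ?case by simp
    qed
    finally show ?thesis by simp
  qed
  then have 1: "distr \<sigma> M fst = M" by (intro measure_eqI) auto
  have "emeasure (distr \<sigma> N snd) A = emeasure N A" if [measurable]: "A \<in> sets N" for A
  proof -
    have "emeasure (distr \<sigma> N snd) A = (\<integral>\<^sup>+ w. \<phi> w * indicator A (snd w) \<partial>(M \<Otimes>\<^sub>M N))"
      by (subst nn_integral_indicator[symmetric], simp, subst nn_integral_distr)
        (simp_all add: \<sigma>_def nn_integral_density)
    also have "\<dots> = (\<integral>\<^sup>+ y. \<integral>\<^sup>+ x. \<phi> (x, y) * indicator A y \<partial>M \<partial>N)"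
      by (subst MN.nn_integral_snd[symmetric]) (simp_all add: split_def)
    also have "\<dots> = (\<integral>\<^sup>+ y. (\<integral>\<^sup>+ x. \<phi> (x, y) \<partial>M) * indicator A y \<partial>N)"
      by (intro nn_integral_cong nn_integral_multc) measurable
    also have "\<dots> = (\<integral>\<^sup>+ y. indicator A y \<partial>N)"
    proof (intro nn_integral_cong_AE, use AE_cell_nonnull[OF v qv] in eventually_elim)
      case (elim y)
      have "(\<integral>\<^sup>+ x. \<phi> (x, y) \<partial>M) = (\<integral>\<^sup>+ x. (if v y = u x then inverse (q (v y)) else 0) \<partial>M)"
        by (intro nn_integral_cong) (auto simp: \<phi>_def)
      also have "\<dots> = 1"
        by (rule nn_integral_same_cell[where q = q, OF M.finite_measure_axioms u q_def elim])
      finally show ?case by simp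
    qed
    finally show ?thesis by simp
  qed
  then have 2: "distr \<sigma> N snd = N" by (intro measure_eqI) auto
  have "AE w in \<sigma>. u (fst w) = v (snd w)"
    unfolding \<sigma>_def by (subst AE_density) (auto simp: \<phi>_def)
  with 1 2 sets_\<sigma> show ?thesis
    by (intro that) (auto simp: couplings_def)
qed

text \<open>The label is the index of the first point of a countable dense sequence within
  \<delta>/2, so two points with one label are both that close to the same point. A
  \<open>LEAST\<close> over countably many open conditions is measurable.\<close>

lemma countable_small_cells:
  fixes \<delta> :: real
  assumes "\<delta> > 0"
  obtains k :: "'c::{metric_space, second_countable_topology} \<Rightarrow> nat"
  where "k \<in> measurable borel (count_space UNIV)" "\<And>x y. k x = k y \<Longrightarrow> dist x y \<le> \<delta>"
proof -
  obtain D :: "'c set" where D: "countable D" "\<And>U. open U \<Longrightarrow> U \<noteq> {} \<Longrightarrow> \<exists>d\<in>D. d \<in> U"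
    by (rule countable_dense_setE) blast
  define e where "e = from_nat_into D"
  define k where "k x = (LEAST n. dist x (e n) < \<delta> / 2)" for x
  have near: "dist x (e (k x)) < \<delta> / 2" for x
  proof -
    obtain d where d: "d \<in> D" "d \<in> ball x (\<delta> / 2)"
      using D(2)[of "ball x (\<delta> / 2)"] assms by auto
    then obtain n where "e n = d"
      using from_nat_into_surj[OF D(1)] by (auto simp: e_def)
    with d have "dist x (e n) < \<delta> / 2" by simp
    then show ?thesis unfolding k_def by (rule LeastI)
  qed
  have "dist x y \<le> \<delta>" if "k x = k y" for x y
    using near[of x] near[of y] that dist_triangle2[of x y "e (k x)"] by auto
  moreover have "k \<in> measurable borel (count_space UNIV)"
    unfolding k_def by measurable
  ultimately show ?thesis using that by blast
qed

subsection \<open>Transport plans of bounded cost\<close>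

text \<open>The bound is witnessed by an actual plan instead of being read off the infimum: infinite
  cost is excluded and plans can be glued directly. The clause \<open>0 \<le> r\<close> makes the
  condition monotone in \<open>r\<close> despite the square.\<close>

definition transport_le :: "('a \<Rightarrow> 'b \<Rightarrow> real) \<Rightarrow> 'a measure \<Rightarrow> 'b measure \<Rightarrow> real \<Rightarrow> bool" where
  "transport_le d P Q r \<longleftrightarrow> 0 \<le> r \<and>
    (\<exists>\<pi>\<in>couplings P Q. (\<integral>\<^sup>+ z. ennreal ((d (fst z) (snd z))\<^sup>2) \<partial>\<pi>) \<le> ennreal (r\<^sup>2))"

lemma transport_le_weaken:
  assumes "transport_le d P Q r" "r \<le> s"
  shows "transport_le d P Q s"
proof -
  have "ennreal (r\<^sup>2) \<le> ennreal (s\<^sup>2)"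
    using assms by (intro ennreal_leI power_mono) (auto simp: transport_le_def)
  then show ?thesis
    using assms unfolding transport_le_def by (meson order_trans)
qed

lemma transport_le_scale:
  assumes "transport_le d P Q r" "\<And>x y. \<bar>d' x y\<bar> \<le> K * d x y" "0 \<le> K"
    and [measurable]: "case_prod d \<in> borel_measurable (P \<Otimes>\<^sub>M Q)"
  shows "transport_le d' P Q (K * r)"
proof -
  obtain \<pi> where \<pi>: "\<pi> \<in> couplings P Q"
    and le: "(\<integral>\<^sup>+ z. ennreal ((d (fst z) (snd z))\<^sup>2) \<partial>\<pi>) \<le> ennreal (r\<^sup>2)" and "0 \<le> r"
    using assms(1) by (auto simp: transport_le_def)
  have [measurable_cong]: "sets \<pi> = sets (P \<Otimes>\<^sub>M Q)" using \<pi> by (simp add: couplings_def)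
  have "(d' x y)\<^sup>2 \<le> K\<^sup>2 * (d x y)\<^sup>2" for x y
    using power_mono[OF assms(2)[of x y], of 2] by (simp add: power_mult_distrib)
  then have "(\<integral>\<^sup>+ z. ennreal ((d' (fst z) (snd z))\<^sup>2) \<partial>\<pi>)
      \<le> (\<integral>\<^sup>+ z. ennreal (K\<^sup>2) * ennreal ((d (fst z) (snd z))\<^sup>2) \<partial>\<pi>)"
    by (intro nn_integral_mono) (simp flip: ennreal_mult)
  also have "\<dots> = ennreal (K\<^sup>2) * (\<integral>\<^sup>+ z. ennreal ((d (fst z) (snd z))\<^sup>2) \<partial>\<pi>)"
    by (intro nn_integral_cmult) measurable
  also have "\<dots> \<le> ennreal (K\<^sup>2) * ennreal (r\<^sup>2)"
    by (intro mult_left_mono le) simp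
  also have "\<dots> = ennreal ((K * r)\<^sup>2)"
    by (simp add: power_mult_distrib flip: ennreal_mult)
  finally show ?thesis
    using \<pi> \<open>0 \<le> r\<close> \<open>0 \<le> K\<close> by (auto simp: transport_le_def)
qed

text \<open>The plan is the joint law of \<open>X\<close> and \<open>Y\<close>, and a probability
  measure integrates the constant \<open>c\<^sup>2\<close> to itself.\<close>

lemma transport_le_joint_law:
  assumes "prob_space M"
    and [measurable]: "X \<in> measurable M A" "Y \<in> measurable M B"
    and [measurable]: "case_prod d \<in> borel_measurable (A \<Otimes>\<^sub>M B)"
    and bound: "AE s in M. \<bar>d (X s) (Y s)\<bar> \<le> c" and "0 \<le> c"
  shows "transport_le d (distr M A X) (distr M B Y) c"
proof -
  interpret prob_space M by fact
  define \<pi> where "\<pi> = distr M (A \<Otimes>\<^sub>M B) (\<lambda>s. (X s, Y s))"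
  have "distr \<pi> (distr M A X) fst = distr M A X" "distr \<pi> (distr M B Y) snd = distr M B Y"
    unfolding \<pi>_def by (simp_all add: distr_distr comp_def cong: distr_cong)
  moreover have "sets \<pi> = sets (distr M A X \<Otimes>\<^sub>M distr M B Y)"
    unfolding \<pi>_def by (simp cong: sets_pair_measure_cong)
  ultimately have "\<pi> \<in> couplings (distr M A X) (distr M B Y)"
    by (simp add: couplings_def)
  moreover have "(\<integral>\<^sup>+ z. ennreal ((d (fst z) (snd z))\<^sup>2) \<partial>\<pi>) = (\<integral>\<^sup>+ s. ennreal ((d (X s) (Y s))\<^sup>2) \<partial>M)"
    unfolding \<pi>_def by (subst nn_integral_distr) simp_all
  moreover have "\<dots> \<le> (\<integral>\<^sup>+ s. ennreal (c\<^sup>2) \<partial>M)"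
    using bound
    by (intro nn_integral_mono_AE, eventually_elim)
      (use \<open>0 \<le> c\<close> in \<open>auto intro!: ennreal_leI simp: abs_le_square_iff[symmetric]\<close>)
  ultimately show ?thesis
    using \<open>0 \<le> c\<close> unfolding transport_le_def by (auto simp: emeasure_space_1 intro!: bexI[of _ \<pi>])
qed

section \<open>Triangle inequality for transport plans\<close>

lemma square_sum3_le:
  fixes u v w a b c :: real
  assumes "a > 0" "b > 0" "c > 0"
  shows "(u + v + w)\<^sup>2 \<le> (a + b + c) * (u\<^sup>2 / a + v\<^sup>2 / b + w\<^sup>2 / c)"
proof -
  have two: "(x + y)\<^sup>2 \<le> (p + q) * (x\<^sup>2 / p + y\<^sup>2 / q)" if "p > 0" "q > 0" for x y p q :: real
  proof -
    \<comment> \<open>Weighted Cauchy-Schwarz, with the defect exhibited as a square. Three terms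
      follow by grouping the first two.\<close>
    have "(p + q) * (x\<^sup>2 / p + y\<^sup>2 / q) - (x + y)\<^sup>2 = (q * x - p * y)\<^sup>2 / (p * q)"
      using that by (simp add: field_simps power2_eq_square)
    also have "\<dots> \<ge> 0" using that by simp
    finally show ?thesis by simp
  qed
  have "(u + v + w)\<^sup>2 \<le> (a + b + c) * ((u + v)\<^sup>2 / (a + b) + w\<^sup>2 / c)"
    using two[of "a + b" c "u + v" w] assms by simp
  also have "\<dots> \<le> (a + b + c) * (u\<^sup>2 / a + v\<^sup>2 / b + w\<^sup>2 / c)"
    using two[of a b u v] assms
    by (intro mult_left_mono add_right_mono) (auto simp: field_simps)
  finally show ?thesis .
qed

text \<open>All three spaces are compared inside the metric space \<open>'c\<close>, so cells are
  only formed there. Gluing on the cell of the middle image lets the two middle images differ by at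
  most \<delta>, which is the extra term. Positive bounds can act as weights in
  \<open>square_sum3_le\<close>.\<close>

lemma transport_le_triangle_pos:
  fixes f :: "'x \<Rightarrow> 'c::{metric_space, second_countable_topology}"
  assumes ab: "a > 0" "b > 0" "\<delta> > 0"
    and "prob_space Q"
    and f[measurable]: "f \<in> borel_measurable P" and g[measurable]: "g \<in> borel_measurable Q"
    and h[measurable]: "h \<in> borel_measurable R"
    and PQ: "transport_le (\<lambda>x y. dist (f x) (g y)) P Q a"
    and QR: "transport_le (\<lambda>y z. dist (g y) (h z)) Q R b"
  shows "transport_le (\<lambda>x z. dist (f x) (h z)) P R (a + b + \<delta>)"
proof -
  interpret Q: prob_space Q by fact
  obtain \<mu> where \<mu>: "\<mu> \<in> couplings P Q"
    and \<mu>a: "(\<integral>\<^sup>+ z. ennreal ((dist (f (fst z)) (g (snd z)))\<^sup>2) \<partial>\<mu>) \<le> ennreal (a\<^sup>2)"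
    using PQ by (auto simp: transport_le_def)
  obtain \<nu> where \<nu>: "\<nu> \<in> couplings Q R"
    and \<nu>b: "(\<integral>\<^sup>+ z. ennreal ((dist (g (fst z)) (h (snd z)))\<^sup>2) \<partial>\<nu>) \<le> ennreal (b\<^sup>2)"
    using QR by (auto simp: transport_le_def)
  have [measurable_cong]: "sets \<mu> = sets (P \<Otimes>\<^sub>M Q)" "sets \<nu> = sets (Q \<Otimes>\<^sub>M R)"
    using \<mu> \<nu> by (simp_all add: couplings_def)
  have \<mu>m: "distr \<mu> P fst = P" "distr \<mu> Q snd = Q"
    and \<nu>m: "distr \<nu> Q fst = Q" "distr \<nu> R snd = R"
    using \<mu> \<nu> by (simp_all add: couplings_def)
  \<comment> \<open>Each coupling inherits total mass 1 from its marginal \<open>Q\<close>.\<close>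
  have "prob_space \<mu>"
    by (rule prob_space_distrD[of snd _ Q]) (simp_all add: \<mu>m Q.prob_space_axioms)
  moreover have "prob_space \<nu>"
    by (rule prob_space_distrD[of fst _ Q]) (simp_all add: \<nu>m Q.prob_space_axioms)
  moreover obtain k :: "'c \<Rightarrow> nat" where k[measurable]: "k \<in> measurable borel (count_space UNIV)"
    and cell: "\<And>x y. k x = k y \<Longrightarrow> dist x y \<le> \<delta>"
    using countable_small_cells[OF \<open>\<delta> > 0\<close>] by blast
  \<comment> \<open>Both labels have the law of \<open>k \<circ> g\<close> under the shared marginal
    \<open>Q\<close>.\<close>
  moreover have "distr \<mu> (count_space UNIV) (\<lambda>w. k (g (snd w)))
      = distr \<nu> (count_space UNIV) (\<lambda>w. k (g (fst w)))"
  proof -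
    have "distr \<mu> (count_space UNIV) (\<lambda>w. k (g (snd w)))
        = distr (distr \<mu> Q snd) (count_space UNIV) (\<lambda>y. k (g y))"
      by (subst distr_distr) (simp_all add: comp_def)
    also have "\<dots> = distr (distr \<nu> Q fst) (count_space UNIV) (\<lambda>y. k (g y))"
      by (simp add: \<mu>m \<nu>m)
    also have "\<dots> = distr \<nu> (count_space UNIV) (\<lambda>w. k (g (fst w)))"
      by (subst distr_distr) (simp_all add: comp_def)
    finally show ?thesis .
  qed
  ultimately obtain \<sigma> where \<sigma>: "\<sigma> \<in> couplings \<mu> \<nu>"
    and same: "AE w in \<sigma>. k (g (snd (fst w))) = k (g (fst (snd w)))"
    by (elim glue_discrete[rotated 4]) (simp_all, measurable)
  have [measurable_cong]: "sets \<sigma> = sets (\<mu> \<Otimes>\<^sub>M \<nu>)" using \<sigma> by (simp add: couplings_def)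
  have \<sigma>m: "distr \<sigma> \<mu> fst = \<mu>" "distr \<sigma> \<nu> snd = \<nu>" using \<sigma> by (simp_all add: couplings_def)
  have "prob_space \<sigma>"
    by (rule prob_space_distrD[of fst _ \<mu>]) (simp_all add: \<sigma>m \<open>prob_space \<mu>\<close>)
  then interpret \<sigma>: prob_space \<sigma> .
  \<comment> \<open>Only the outer coordinates are kept; the two middle coordinates have images in
    one cell but need not coincide.\<close>
  define \<rho> where "\<rho> = distr \<sigma> (P \<Otimes>\<^sub>M R) (\<lambda>w. (fst (fst w), snd (snd w)))"
  have "distr \<rho> P fst = distr (distr \<sigma> \<mu> fst) P fst"
    unfolding \<rho>_def by (simp add: distr_distr comp_def)
  moreover have "distr \<rho> R snd = distr (distr \<sigma> \<nu> snd) R snd"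
    unfolding \<rho>_def by (simp add: distr_distr comp_def)
  ultimately have \<rho>: "\<rho> \<in> couplings P R"
    by (simp add: couplings_def \<sigma>m \<mu>m \<nu>m) (simp add: \<rho>_def)
  \<comment> \<open>The weights are the bounds on the three parts themselves. The integrated terms
    are then at most \<open>s * a\<close>, \<open>s * b\<close> and \<open>s * \<delta>\<close>,
    which add up to \<open>s\<^sup>2\<close>.\<close>
  define s where "s = a + b + \<delta>"
  have "s > 0" using ab by (simp add: s_def)
  let ?u = "\<lambda>w. dist (f (fst w)) (g (snd w))" and ?v = "\<lambda>w. dist (g (fst w)) (h (snd w))"
  have "(\<integral>\<^sup>+ z. ennreal ((dist (f (fst z)) (h (snd z)))\<^sup>2) \<partial>\<rho>)
      = (\<integral>\<^sup>+ w. ennreal ((dist (f (fst (fst w))) (h (snd (snd w))))\<^sup>2) \<partial>\<sigma>)"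
    unfolding \<rho>_def by (subst nn_integral_distr) simp_all
  also have "\<dots> \<le> (\<integral>\<^sup>+ w. ennreal (s / a) * ennreal ((?u (fst w))\<^sup>2)
      + ennreal (s / b) * ennreal ((?v (snd w))\<^sup>2) + ennreal (s * \<delta>) \<partial>\<sigma>)"
  proof (intro nn_integral_mono_AE, use same in eventually_elim)
    case (elim w)
    have "dist (f (fst (fst w))) (h (snd (snd w))) \<le> ?u (fst w) + ?v (snd w) + \<delta>"
      using cell[OF elim] dist_triangle[of "f (fst (fst w))" "h (snd (snd w))" "g (snd (fst w))"]
        dist_triangle[of "g (snd (fst w))" "h (snd (snd w))" "g (fst (snd w))"] by linarith
    then have "(dist (f (fst (fst w))) (h (snd (snd w))))\<^sup>2 \<le> (?u (fst w) + ?v (snd w) + \<delta>)\<^sup>2"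
      by (intro power_mono) auto
    also have "\<dots> \<le> s * ((?u (fst w))\<^sup>2 / a + (?v (snd w))\<^sup>2 / b + \<delta>\<^sup>2 / \<delta>)"
      unfolding s_def by (rule square_sum3_le[OF ab])
    also have "\<dots> = s / a * (?u (fst w))\<^sup>2 + s / b * (?v (snd w))\<^sup>2 + s * \<delta>"
      using ab by (simp add: field_simps power2_eq_square)
    finally show ?case
      using ab \<open>s > 0\<close> by (simp add: ennreal_leI flip: ennreal_mult ennreal_plus)
  qed
  also have "\<dots> = ennreal (s / a) * (\<integral>\<^sup>+ w. ennreal ((?u (fst w))\<^sup>2) \<partial>\<sigma>)
      + ennreal (s / b) * (\<integral>\<^sup>+ w. ennreal ((?v (snd w))\<^sup>2) \<partial>\<sigma>) + ennreal (s * \<delta>)"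
    by (simp add: nn_integral_add nn_integral_cmult \<sigma>.emeasure_space_1)
  also have "(\<integral>\<^sup>+ w. ennreal ((?u (fst w))\<^sup>2) \<partial>\<sigma>) = (\<integral>\<^sup>+ w. ennreal ((?u w)\<^sup>2) \<partial>\<mu>)"
    using nn_integral_distr[of fst \<sigma> \<mu> "\<lambda>w. ennreal ((?u w)\<^sup>2)"] by (simp add: \<sigma>m)
  also have "(\<integral>\<^sup>+ w. ennreal ((?v (snd w))\<^sup>2) \<partial>\<sigma>) = (\<integral>\<^sup>+ w. ennreal ((?v w)\<^sup>2) \<partial>\<nu>)"
    using nn_integral_distr[of snd \<sigma> \<nu> "\<lambda>w. ennreal ((?v w)\<^sup>2)"] by (simp add: \<sigma>m)
  also have "ennreal (s / a) * (\<integral>\<^sup>+ w. ennreal ((?u w)\<^sup>2) \<partial>\<mu>)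
        + ennreal (s / b) * (\<integral>\<^sup>+ w. ennreal ((?v w)\<^sup>2) \<partial>\<nu>) + ennreal (s * \<delta>)
      \<le> ennreal (s / a) * ennreal (a\<^sup>2) + ennreal (s / b) * ennreal (b\<^sup>2) + ennreal (s * \<delta>)"
    by (intro add_mono mult_left_mono \<mu>a \<nu>b) simp_all
  also have "\<dots> = ennreal (s / a * a\<^sup>2 + s / b * b\<^sup>2 + s * \<delta>)"
    using ab \<open>s > 0\<close> by (simp flip: ennreal_mult ennreal_plus)
  also have "s / a * a\<^sup>2 + s / b * b\<^sup>2 + s * \<delta> = s\<^sup>2"
    using ab by (simp add: s_def field_simps power2_eq_square)
  finally show ?thesis
    using \<rho> \<open>s > 0\<close> unfolding transport_le_def s_def by auto
qed

text \<open>A zero bound cannot be a weight, so \<open>a\<close> and \<open>b\<close> are each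
  enlarged by \<delta>/3 and the last third is left for the cell diameter.\<close>

lemma transport_le_triangle:
  fixes f :: "'x \<Rightarrow> 'c::{metric_space, second_countable_topology}"
  assumes "\<delta> > 0" "prob_space Q"
    and "f \<in> borel_measurable P" "g \<in> borel_measurable Q" "h \<in> borel_measurable R"
    and PQ: "transport_le (\<lambda>x y. dist (f x) (g y)) P Q a"
    and QR: "transport_le (\<lambda>y z. dist (g y) (h z)) Q R b"
  shows "transport_le (\<lambda>x z. dist (f x) (h z)) P R (a + b + \<delta>)"
proof -
  have "0 \<le> a" "0 \<le> b" using PQ QR by (simp_all add: transport_le_def)
  then have "transport_le (\<lambda>x z. dist (f x) (h z)) P R ((a + \<delta> / 3) + (b + \<delta> / 3) + \<delta> / 3)"
    using assms(1-5)
    by (intro transport_le_triangle_pos[where Q = Q and f = f and g = g and h = h]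
        transport_le_weaken[OF PQ] transport_le_weaken[OF QR]) simp_all
  then show ?thesis by (simp add: add_ac)
qed

text \<open>The middle leg costs \<open>r\<close>, and \<open>a\<close> and \<open>b\<close> are the
  noise of the outer legs; each of the two compositions uses half of \<delta>.\<close>

lemma transport_le_chain:
  fixes f :: "'x \<Rightarrow> 'c::{metric_space, second_countable_topology}"
  assumes "\<delta> > 0" "prob_space Q" "prob_space R"
    and "f \<in> borel_measurable P" "g \<in> borel_measurable Q"
    and "h \<in> borel_measurable R" "k \<in> borel_measurable S"
    and "transport_le (\<lambda>x y. dist (f x) (g y)) P Q a"
    and "transport_le (\<lambda>y z. dist (g y) (h z)) Q R r"
    and "transport_le (\<lambda>z w. dist (h z) (k w)) R S b"
  shows "transport_le (\<lambda>x w. dist (f x) (k w)) P S (r + (a + b) + \<delta>)"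
proof -
  have "transport_le (\<lambda>x z. dist (f x) (h z)) P R (a + r + \<delta> / 2)"
    using assms by (intro transport_le_triangle[where Q = Q and f = f and g = g and h = h]) simp_all
  then have "transport_le (\<lambda>x w. dist (f x) (k w)) P S (a + r + \<delta> / 2 + b + \<delta> / 2)"
    using assms by (intro transport_le_triangle[where Q = R and f = f and g = h and h = k]) simp_all
  then show ?thesis by (simp add: add_ac)
qed

section \<open>From plans to the Wasserstein distance\<close>

lemma wasserstein2_nonneg: "0 \<le> wasserstein2 d P Q"
  by (simp add: wasserstein2_def)

lemma wasserstein2_le:
  assumes "transport_le d P Q r"
  shows "wasserstein2 d P Q \<le> r"
proof -
  have "(INF \<pi>\<in>couplings P Q. \<integral>\<^sup>+ z. ennreal ((d (fst z) (snd z))\<^sup>2) \<partial>\<pi>) \<le> ennreal (r\<^sup>2)"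
    using assms unfolding transport_le_def by (auto intro: INF_lower2)
  then have "enn2real (INF \<pi>\<in>couplings P Q. \<integral>\<^sup>+ z. ennreal ((d (fst z) (snd z))\<^sup>2) \<partial>\<pi>) \<le> r\<^sup>2"
    by (intro enn2real_leI) simp_all
  then show ?thesis
    using assms unfolding wasserstein2_def transport_le_def by (intro real_le_lsqrt) auto
qed

text \<open>The first premise makes the infimum finite, so \<open>enn2real\<close> preserves it and
  the strict inequality produces a plan of cost below \<open>s\<^sup>2\<close>.\<close>

lemma transport_le_of_wasserstein2_less:
  assumes "transport_le d P Q r" "wasserstein2 d P Q < s"
  shows "transport_le d P Q s"
proof -
  let ?I = "INF \<pi>\<in>couplings P Q. \<integral>\<^sup>+ z. ennreal ((d (fst z) (snd z))\<^sup>2) \<partial>\<pi>"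
  have "?I \<le> ennreal (r\<^sup>2)"
    using assms(1) unfolding transport_le_def by (auto intro: INF_lower2)
  then have "?I < \<top>" by (simp add: le_less_trans)
  have "0 < s" using wasserstein2_nonneg assms(2) by (rule le_less_trans)
  then have "enn2real ?I < s\<^sup>2"
    using assms(2) real_sqrt_less_iff[of "enn2real ?I" "s\<^sup>2"]
    unfolding wasserstein2_def by simp
  then have "?I < ennreal (s\<^sup>2)"
    using \<open>?I < \<top>\<close> \<open>0 < s\<close> ennreal_lessI[of "s\<^sup>2" "enn2real ?I"] by simp
  then obtain \<pi> where "\<pi> \<in> couplings P Q" "(\<integral>\<^sup>+ z. ennreal ((d (fst z) (snd z))\<^sup>2) \<partial>\<pi>) < ennreal (s\<^sup>2)"
    by (auto simp: INF_less_iff)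
  then show ?thesis
    using \<open>0 < s\<close> unfolding transport_le_def by (auto intro: less_imp_le)
qed

text \<open>A finite cost would itself give a bound, namely its square root. Hence the infimum is
  \<open>\<top>\<close>, which \<open>enn2real\<close> sends to 0.\<close>

lemma wasserstein2_eq_0_of_no_transport:
  assumes "\<And>r. \<not> transport_le d P Q r"
  shows "wasserstein2 d P Q = 0"
proof -
  have "(\<integral>\<^sup>+ z. ennreal ((d (fst z) (snd z))\<^sup>2) \<partial>\<pi>) = \<top>" if "\<pi> \<in> couplings P Q" for \<pi>
  proof (rule ccontr)
    let ?J = "\<integral>\<^sup>+ z. ennreal ((d (fst z) (snd z))\<^sup>2) \<partial>\<pi>"
    assume "?J \<noteq> \<top>"
    then have "?J = ennreal ((sqrt (enn2real ?J))\<^sup>2)"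
      by (simp add: less_top)
    with that have "transport_le d P Q (sqrt (enn2real ?J))"
      unfolding transport_le_def by (auto intro!: bexI[of _ \<pi>])
    with assms show False by blast
  qed
  then have "(INF \<pi>\<in>couplings P Q. \<integral>\<^sup>+ z. ennreal ((d (fst z) (snd z))\<^sup>2) \<partial>\<pi>) = \<top>"
    by (auto simp: INF_eq_iff cong: INF_cong)
  then show ?thesis by (simp add: wasserstein2_def)
qed

text \<open>
  The converse transfer of plans covers infinite transport cost, where \<open>wasserstein2\<close> has the
  junk value \<open>0\<close>: it forces the cost to be infinite on both sides.
\<close>

lemma wasserstein2_le_affine:
  assumes "0 \<le> K"
    and fwd: "\<And>r e. 0 < e \<Longrightarrow> transport_le d P Q r \<Longrightarrow> transport_le d' P' Q' (K * r + c + e)"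
    and bwd: "\<And>r. transport_le d' P' Q' r \<Longrightarrow> \<exists>s. transport_le d P Q s" and "0 \<le> c"
  shows "wasserstein2 d' P' Q' \<le> K * wasserstein2 d P Q + c"
proof (cases "\<exists>r. transport_le d P Q r")
  case True
  then obtain r where r: "transport_le d P Q r" ..
  show ?thesis
  proof (rule field_le_epsilon)
    fix e :: real assume "0 < e"
    \<comment> \<open>The slack enters \<open>K\<close> times through the near-optimal plan and once
      more through \<open>fwd\<close>, in total \<open>(K + 1) * \<eta> = e\<close>.\<close>
    define \<eta> where "\<eta> = e / (K + 1)"
    have "0 < \<eta>" using \<open>0 < e\<close> \<open>0 \<le> K\<close> by (simp add: \<eta>_def)
    then have "transport_le d P Q (wasserstein2 d P Q + \<eta>)"
      by (intro transport_le_of_wasserstein2_less[OF r]) simp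
    then have "wasserstein2 d' P' Q' \<le> K * (wasserstein2 d P Q + \<eta>) + c + \<eta>"
      by (intro wasserstein2_le fwd \<open>0 < \<eta>\<close>)
    also have "\<dots> = K * wasserstein2 d P Q + c + (K + 1) * \<eta>"
      by (simp add: algebra_simps)
    also have "(K + 1) * \<eta> = e" using \<open>0 \<le> K\<close> by (simp add: \<eta>_def)
    finally show "wasserstein2 d' P' Q' \<le> K * wasserstein2 d P Q + c + e" .
  qed
next
  case False
  with bwd have "wasserstein2 d' P' Q' = 0"
    by (intro wasserstein2_eq_0_of_no_transport) blast
  then show ?thesis
    using assms wasserstein2_nonneg[of d P Q] by simp
qed

subsection \<open>Laws of exposures\<close>

theorem corollary1:
  fixes \<Gamma> \<Gamma>half :: "'h::{real_inner, polish_space} \<Rightarrow>\<^sub>L 'h"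
    and t :: "'a::polish_space \<Rightarrow> 'h"
    and L :: real
    and \<U> \<nu> :: "'u measure"
    and T :: "'a \<times> 'u \<Rightarrow> 'h"
    and C\<^sub>i C\<^sub>j :: "'a measure"
    and M\<^sub>i :: "'s measure" and M\<^sub>j :: "'r measure"
    and X\<^sub>i :: "'s \<Rightarrow> 'a" and X\<^sub>j :: "'r \<Rightarrow> 'a"
    and U\<^sub>i :: "'s \<Rightarrow> 'u" and U\<^sub>j :: "'r \<Rightarrow> 'u"
    and B\<^sub>i :: "'s \<Rightarrow> 'h" and B\<^sub>j :: "'r \<Rightarrow> 'h"
    and \<epsilon>\<^sub>i \<epsilon>\<^sub>j :: "'a \<times> 'u \<Rightarrow> 'h"
    and \<tau>\<^sub>i \<tau>\<^sub>j :: real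
    and P\<^sub>i P\<^sub>j :: "'h measure"
  assumes "positive_selfadjoint \<Gamma>"
    and "is_positive_sqrt \<Gamma>half \<Gamma>"
    and "t \<in> borel_measurable borel"
    and "borel_embedding (\<lambda>x. \<Gamma>half (t x))"
    and "L \<ge> 1"
    and "\<And>x y. inverse L * dist x y \<le> norm (\<Gamma>half (t x) - \<Gamma>half (t y))"
    and "\<And>x y. norm (\<Gamma>half (t x) - \<Gamma>half (t y)) \<le> L * dist x y"
    and "T \<in> borel_measurable (borel \<Otimes>\<^sub>M \<U>)"
    and "C\<^sub>i \<in> second_moment_measures" and "C\<^sub>j \<in> second_moment_measures"
    and "prob_space M\<^sub>i" and "prob_space M\<^sub>j"
    and "X\<^sub>i \<in> borel_measurable M\<^sub>i" and "distr M\<^sub>i borel X\<^sub>i = C\<^sub>i"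
    and "X\<^sub>j \<in> borel_measurable M\<^sub>j" and "distr M\<^sub>j borel X\<^sub>j = C\<^sub>j"
    and "U\<^sub>i \<in> measurable M\<^sub>i \<U>" and "distr M\<^sub>i \<U> U\<^sub>i = \<nu>"
    and "U\<^sub>j \<in> measurable M\<^sub>j \<U>" and "distr M\<^sub>j \<U> U\<^sub>j = \<nu>"
    and "\<And>s. B\<^sub>i s = T (X\<^sub>i s, U\<^sub>i s)"
    and "\<And>r. B\<^sub>j r = T (X\<^sub>j r, U\<^sub>j r)"
    and "AE s in M\<^sub>i. B\<^sub>i s = t (X\<^sub>i s) + \<epsilon>\<^sub>i (X\<^sub>i s, U\<^sub>i s)"
    and "AE r in M\<^sub>j. B\<^sub>j r = t (X\<^sub>j r) + \<epsilon>\<^sub>j (X\<^sub>j r, U\<^sub>j r)"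
    and "\<epsilon>\<^sub>i \<in> borel_measurable (borel \<Otimes>\<^sub>M \<U>)"
    and "\<epsilon>\<^sub>j \<in> borel_measurable (borel \<Otimes>\<^sub>M \<U>)"
    and "\<tau>\<^sub>i \<ge> 0" and "\<And>x u. u \<in> space \<U> \<Longrightarrow> norm (\<Gamma>half (\<epsilon>\<^sub>i (x, u))) \<le> \<tau>\<^sub>i"
    and "\<tau>\<^sub>j \<ge> 0" and "\<And>x u. u \<in> space \<U> \<Longrightarrow> norm (\<Gamma>half (\<epsilon>\<^sub>j (x, u))) \<le> \<tau>\<^sub>j"
    and "P\<^sub>i = distr M\<^sub>i borel B\<^sub>i" and "P\<^sub>j = distr M\<^sub>j borel B\<^sub>j"
    and "P\<^sub>i = C\<^sub>i \<bind> (\<lambda>x. distr \<nu> borel (\<lambda>u. T (x, u)))"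
    and "P\<^sub>j = C\<^sub>j \<bind> (\<lambda>x. distr \<nu> borel (\<lambda>u. T (x, u)))"
    and "P\<^sub>i \<in> second_moment_measures" and "P\<^sub>j \<in> second_moment_measures"
  shows "max (inverse L * wasserstein2 dist C\<^sub>i C\<^sub>j - (\<tau>\<^sub>i + \<tau>\<^sub>j)) 0
      \<le> wasserstein2 (\<lambda>b b'. norm (\<Gamma>half b - \<Gamma>half b')) P\<^sub>i P\<^sub>j
    \<and> wasserstein2 (\<lambda>b b'. norm (\<Gamma>half b - \<Gamma>half b')) P\<^sub>i P\<^sub>j
      \<le> L * wasserstein2 dist C\<^sub>i C\<^sub>j + (\<tau>\<^sub>i + \<tau>\<^sub>j)"
proof -
  interpret Mi: prob_space M\<^sub>i by fact
  interpret Mj: prob_space M\<^sub>j by fact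
  define f where "f x = \<Gamma>half (t x)" for x
  have \<Gamma>_meas[measurable]: "blinfun_apply \<Gamma>half \<in> borel_measurable borel"
    by (intro borel_measurable_continuous_onI continuous_intros)
  note [measurable] = assms(3,8,13,15,17,19)
  have f_meas[measurable]: "f \<in> borel_measurable borel"
    unfolding f_def by measurable
  have Ci: "C\<^sub>i = distr M\<^sub>i borel X\<^sub>i" and Cj: "C\<^sub>j = distr M\<^sub>j borel X\<^sub>j"
    and Pi: "P\<^sub>i = distr M\<^sub>i borel B\<^sub>i" and Pj: "P\<^sub>j = distr M\<^sub>j borel B\<^sub>j"
    using assms by simp_all
  have [measurable]: "B\<^sub>i \<in> borel_measurable M\<^sub>i" "B\<^sub>j \<in> borel_measurable M\<^sub>j"
    unfolding assms(21,22)[abs_def] by measurable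
  have sets_eq[measurable_cong]: "sets C\<^sub>i = sets borel" "sets C\<^sub>j = sets borel"
    "sets P\<^sub>i = sets borel" "sets P\<^sub>j = sets borel"
    by (simp_all add: Ci Cj Pi Pj)
  have prob: "prob_space C\<^sub>i" "prob_space C\<^sub>j" "prob_space P\<^sub>i" "prob_space P\<^sub>j"
    unfolding Ci Cj Pi Pj by (intro Mi.prob_space_distr Mj.prob_space_distr; measurable)+
  \<comment> \<open>The noise bound is stated on \<open>space \<U>\<close>; \<open>AE_space\<close>
    places \<open>s\<close> in the sample space, and measurability then places
    \<open>U\<^sub>i s\<close> in \<open>space \<U>\<close>.\<close>
  have noise_i: "AE s in M\<^sub>i. dist (f (X\<^sub>i s)) (\<Gamma>half (B\<^sub>i s)) \<le> \<tau>\<^sub>i"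
    using assms(23) AE_space
  proof eventually_elim
    case (elim s)
    then have "U\<^sub>i s \<in> space \<U>" using measurable_space[OF assms(17)] by blast
    with assms(28)[of "U\<^sub>i s" "X\<^sub>i s"] elim show ?case
      by (simp add: f_def dist_norm blinfun.add_right)
  qed
  have noise_j: "AE s in M\<^sub>j. dist (f (X\<^sub>j s)) (\<Gamma>half (B\<^sub>j s)) \<le> \<tau>\<^sub>j"
    using assms(24) AE_space
  proof eventually_elim
    case (elim s)
    then have "U\<^sub>j s \<in> space \<U>" using measurable_space[OF assms(19)] by blast
    with assms(30)[of "U\<^sub>j s" "X\<^sub>j s"] elim show ?case
      by (simp add: f_def dist_norm blinfun.add_right)
  qed
  \<comment> \<open>Plans in both directions are recorded because chains run head to tail:
    \<open>P\<^sub>i\<close>, \<open>C\<^sub>i\<close>, \<open>C\<^sub>j\<close>,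
    \<open>P\<^sub>j\<close> for the upper bound and \<open>C\<^sub>i\<close>,
    \<open>P\<^sub>i\<close>, \<open>P\<^sub>j\<close>, \<open>C\<^sub>j\<close> for the lower
    one.\<close>
  have CP_i: "transport_le (\<lambda>x b. dist (f x) (\<Gamma>half b)) C\<^sub>i P\<^sub>i \<tau>\<^sub>i"
    unfolding Ci Pi using noise_i assms(11,27) by (intro transport_le_joint_law) simp_all
  have PC_i: "transport_le (\<lambda>b x. dist (\<Gamma>half b) (f x)) P\<^sub>i C\<^sub>i \<tau>\<^sub>i"
    unfolding Ci Pi using noise_i assms(11,27)
    by (intro transport_le_joint_law) (simp_all add: dist_commute)
  have CP_j: "transport_le (\<lambda>x b. dist (f x) (\<Gamma>half b)) C\<^sub>j P\<^sub>j \<tau>\<^sub>j"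
    unfolding Cj Pj using noise_j assms(12,29) by (intro transport_le_joint_law) simp_all
  have PC_j: "transport_le (\<lambda>b x. dist (\<Gamma>half b) (f x)) P\<^sub>j C\<^sub>j \<tau>\<^sub>j"
    unfolding Cj Pj using noise_j assms(12,29)
    by (intro transport_le_joint_law) (simp_all add: dist_commute)
  have f_upper: "dist (f x) (f y) \<le> L * dist x y" for x y
    using assms(7)[of x y] by (simp add: f_def dist_norm)
  have f_lower: "dist x y \<le> L * dist (f x) (f y)" for x y
    using assms(5) assms(6)[of x y] by (simp add: f_def dist_norm field_simps)
  define d\<Gamma> where "d\<Gamma> = (\<lambda>b b'. dist (\<Gamma>half b) (\<Gamma>half b'))"
  have C_to_P: "transport_le d\<Gamma> P\<^sub>i P\<^sub>j (L * r + (\<tau>\<^sub>i + \<tau>\<^sub>j) + e)"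
    if "0 < e" "transport_le dist C\<^sub>i C\<^sub>j r" for r e
  proof -
    have "transport_le (\<lambda>x y. dist (f x) (f y)) C\<^sub>i C\<^sub>j (L * r)"
      by (rule transport_le_scale[OF that(2)]) (use f_upper assms(5) in simp_all)
    then show ?thesis
      unfolding d\<Gamma>_def using that(1) prob PC_i CP_j
      by (intro transport_le_chain[where Q = C\<^sub>i and R = C\<^sub>j and g = f and h = f
            and f = "blinfun_apply \<Gamma>half" and k = "blinfun_apply \<Gamma>half"]) simp_all
  qed
  have P_to_C: "transport_le dist C\<^sub>i C\<^sub>j (L * r + L * (\<tau>\<^sub>i + \<tau>\<^sub>j) + e)"
    if "0 < e" "transport_le d\<Gamma> P\<^sub>i P\<^sub>j r" for r e
  proof -
    \<comment> \<open>The chain bounds distances between carrier images; returning to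
      \<open>dist\<close> on characteristics multiplies everything by \<open>L\<close>, so the slack
      is taken as \<open>e / L\<close>.\<close>
    have "transport_le (\<lambda>x y. dist (f x) (f y)) C\<^sub>i C\<^sub>j (r + (\<tau>\<^sub>i + \<tau>\<^sub>j) + e / L)"
      using that prob CP_i PC_j assms(5) unfolding d\<Gamma>_def
      by (intro transport_le_chain[where Q = P\<^sub>i and R = P\<^sub>j and g = "blinfun_apply \<Gamma>half"
            and h = "blinfun_apply \<Gamma>half" and f = f and k = f]) simp_all
    then have "transport_le dist C\<^sub>i C\<^sub>j (L * (r + (\<tau>\<^sub>i + \<tau>\<^sub>j) + e / L))"
      by (rule transport_le_scale) (use f_lower assms(5) in simp_all)
    then show ?thesis using assms(5) by (simp add: algebra_simps)
  qed
  \<comment> \<open>\<open>P_to_C\<close> with slack 1 only supplies the converse transfer: without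
    a finite-cost plan between characteristics there is none between exposures.\<close>
  have upper: "wasserstein2 d\<Gamma> P\<^sub>i P\<^sub>j \<le> L * wasserstein2 dist C\<^sub>i C\<^sub>j + (\<tau>\<^sub>i + \<tau>\<^sub>j)"
    using C_to_P P_to_C[OF zero_less_one] assms(5,27,29)
    by (intro wasserstein2_le_affine) (simp_all, blast)
  have lower: "wasserstein2 dist C\<^sub>i C\<^sub>j \<le> L * wasserstein2 d\<Gamma> P\<^sub>i P\<^sub>j + L * (\<tau>\<^sub>i + \<tau>\<^sub>j)"
    using P_to_C C_to_P[OF zero_less_one] assms(5,27,29)
    by (intro wasserstein2_le_affine) (simp_all, blast)
  \<comment> \<open>Division by \<open>L\<close> removes the factor that the noise acquired in
    \<open>lower\<close>, leaving exactly \<open>\<tau>\<^sub>i + \<tau>\<^sub>j\<close>.\<close>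
  have "inverse L * wasserstein2 dist C\<^sub>i C\<^sub>j - (\<tau>\<^sub>i + \<tau>\<^sub>j) \<le> wasserstein2 d\<Gamma> P\<^sub>i P\<^sub>j"
    using lower assms(5) by (simp add: field_simps)
  with upper wasserstein2_nonneg[of d\<Gamma> P\<^sub>i P\<^sub>j] show ?thesis
    by (simp add: d\<Gamma>_def dist_norm)
qed

end
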